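(* Let $1\le m<n$ be integers and let $X_1,\dots,X_n$ be real-valued random variables on a common probability space, all having finite moments of every order, such that the random vectors $(X_1,\dots,X_m)$ and $(X_{m+1},\dots,X_n)$ are independent and each $X_i$ is nondegenerate. Suppose that the distribution of the statistic $\sum_{i=1}^n (X_i+a_i)^2$, where $a_1,\dots,a_n\in\mathbb{R}$, depends only on $\sum_{i=1}^n a_i^2$. Then the random variables $X_1,\dots,X_n$ are independent and have the same normal distribution with zero mean.
   Context: A random variable is nondegenerate if it is not almost surely constant. "The distribution depends only on $\sum_{i=1}^n a_i^2$" means: whenever $(a_i),(a_i')\in\mathbb{R}^n$ satisfy $\sum_i a_i^2=\sum_i a_i'^2$, the random variables $\sum_i (X_i+a_i)^2$ and $\sum_i (X_i+a_i')^2$ have the same distribution. Independence of the two vectors does not assume anything about the dependence among the components of each vector; independence of $X_1,\dots,X_n$ in the conclusion is joint (mutual) independence. *)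

theory Defs
  imports "HOL-Probability.Probability"
begin

definition nondegenerate :: "'a measure \<Rightarrow> ('a \<Rightarrow> real) \<Rightarrow> bool" where
  "nondegenerate M Y \<longleftrightarrow> \<not> (\<exists>c. AE \<omega> in M. Y \<omega> = c)"

definition finite_moments :: "'a measure \<Rightarrow> ('a \<Rightarrow> real) \<Rightarrow> bool" where
  "finite_moments M Y \<longleftrightarrow> (\<forall>k::nat. integrable M (\<lambda>\<omega>. \<bar>Y \<omega>\<bar> ^ k))"

end

(* For a = t u with t tending to infinity the centred and rescaled statistic converges to the
   linear form u . X, so the joint characteristic function of X at u depends only on |u|.
   Since X 1 and X n are independent, the radial profile f satisfies
   f (sqrt (s^2 + t^2)) = f s * f t, so f t = exp (- c * t^2) by Cauchy's functional equation.
   Hence the joint characteristic function is the product of Gaussian ones, and X is an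
   independent Gaussian family by Kac's theorem (and c > 0 by nondegeneracy).
   Kac's theorem is reduced to one-dimensional uniqueness by replacing the factors
   exp (i u_j X_j) one at a time by the indicator of X_j in B_j, the remaining factors acting as a bounded
   complex weight. *)
theory Submission
  imports Defs
begin

section \<open>Uniqueness of characteristic functions under bounded weights, and Kac's
  theorem\<close>

lemma (in prob_space) weighted_char_unique_real:
  fixes W Y :: "'a \<Rightarrow> real"
  assumes [measurable]: "W \<in> borel_measurable M" "Y \<in> borel_measurable M"
    and bound: "\<And>\<omega>. \<bar>W \<omega>\<bar> \<le> C"
    and eq: "\<And>t. (CLINT \<omega>|M. of_real (W \<omega>) * iexp (t * Y \<omega>))
                  = of_real K * (CLINT \<omega>|M. iexp (t * Y \<omega>))"
    and [measurable]: "B \<in> sets borel"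
  shows "(LINT \<omega>|M. W \<omega> * indicator B (Y \<omega>)) = K * (LINT \<omega>|M. indicator B (Y \<omega>))"
proof -
  have intW: "integrable M W"
    by (rule integrable_const_bound[of _ C]) (use bound in auto)
  \<comment> \<open>At \<open>t = 0\<close> the hypothesis forces \<open>K\<close> to be the mean of
    \<open>W\<close>. Hence \<open>k\<close> below is the total mass of the shifted weight
    \<open>V\<close>.\<close>
  have "(CLINT \<omega>|M. of_real (W \<omega>)) = of_real K"
    using eq[of 0] by (simp add: prob_space)
  then have KW: "K = (LINT \<omega>|M. W \<omega>)"
    by simp
  \<comment> \<open>Adding a constant to \<open>W\<close> gives a positive weight, hence after normalisation a probability
    density, to which the uniqueness theorem for characteristic functions applies.\<close>
  define k where "k = K + C + 1"
  define V where "V \<omega> = W \<omega> + C + 1" for \<omega>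
  have V1: "V \<omega> \<ge> 1" for \<omega>
    using bound[of \<omega>] by (simp add: V_def)
  have [measurable]: "V \<in> borel_measurable M"
    unfolding V_def by measurable
  have intV: "integrable M V"
    unfolding V_def using intW by simp
  have k: "k = (LINT \<omega>|M. V \<omega>)"
    using intW by (simp add: V_def k_def KW prob_space)
  have "1 \<le> k"
    unfolding k using integral_mono[of M "\<lambda>_. 1" V] V1 intV by (simp add: prob_space)
  then have kpos: "k > 0" by simp
  have nn: "0 \<le> V \<omega> / k" for \<omega>
    using V1[of \<omega>] kpos by simp
  define N where "N = density M (\<lambda>\<omega>. V \<omega> / k)"
  have [measurable]: "Y \<in> borel_measurable N"
    by (simp add: N_def)
  interpret N: prob_space N
  proof
    have "emeasure N (space N) = (\<integral>\<^sup>+\<omega>. ennreal (V \<omega> / k) \<partial>M)"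
      by (simp add: N_def emeasure_density cong: nn_integral_cong)
    also have "\<dots> = ennreal (LINT \<omega>|M. V \<omega> / k)"
      by (rule nn_integral_eq_integral) (use intV nn in auto)
    also have "\<dots> = 1"
      using k kpos by simp
    finally show "emeasure N (space N) = 1" .
  qed
  have "distr N borel Y = distr M borel Y"
  proof (rule Levy_uniqueness)
    show "real_distribution (distr N borel Y)" "real_distribution (distr M borel Y)"
      by (auto intro: N.real_distribution_distr real_distribution_distr)
    show "char (distr N borel Y) = char (distr M borel Y)"
    proof
      fix t
      have i: "integrable M (\<lambda>\<omega>. iexp (t * Y \<omega>))"
        by (rule integrable_const_bound[of _ 1]) auto
      have i': "integrable M (\<lambda>\<omega>. of_real (W \<omega>) * iexp (t * Y \<omega>))"
        by (rule integrable_const_bound[of _ C]) (use bound in \<open>auto simp: norm_mult\<close>)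
      have "char (distr N borel Y) t = (CLINT \<omega>|M. (V \<omega> / k) *\<^sub>R iexp (t * Y \<omega>))"
        unfolding char_def by (simp add: integral_distr N_def integral_density nn)
      also have "\<dots> = (CLINT \<omega>|M. (of_real (W \<omega>) * iexp (t * Y \<omega>)
                          + of_real (C + 1) * iexp (t * Y \<omega>)) / of_real k)"
        by (rule Bochner_Integration.integral_cong)
           (auto simp: V_def scaleR_conv_of_real field_simps)
      also have "\<dots> = ((CLINT \<omega>|M. of_real (W \<omega>) * iexp (t * Y \<omega>))
                          + of_real (C + 1) * (CLINT \<omega>|M. iexp (t * Y \<omega>))) / of_real k"
        using i i' by simp
      also have "\<dots> = of_real k * (CLINT \<omega>|M. iexp (t * Y \<omega>)) / of_real k"
        unfolding eq by (simp add: k_def algebra_simps)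
      also have "\<dots> = char (distr M borel Y) t"
        using kpos by (simp add: char_def integral_distr)
      finally show "char (distr N borel Y) t = char (distr M borel Y) t" .
    qed
  qed
  then have "(LINT y|distr N borel Y. indicator B y) = (LINT y|distr M borel Y. indicator B y :: real)"
    by simp
  then have *: "(LINT \<omega>|M. (V \<omega> / k) * indicator B (Y \<omega>)) = (LINT \<omega>|M. indicator B (Y \<omega>))"
    by (simp add: integral_distr N_def integral_density nn del: Bochner_Integration.integral_indicator)
  have i: "integrable M (\<lambda>\<omega>. indicator B (Y \<omega>) :: real)"
    by (rule integrable_const_bound[of _ 1]) (auto simp: indicator_def)
  have i': "integrable M (\<lambda>\<omega>. W \<omega> * indicator B (Y \<omega>))"
    by (rule integrable_const_bound[of _ C])
       (use bound in \<open>auto simp: indicator_def intro: order_trans[OF abs_ge_zero]\<close>)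
  \<comment> \<open>Undo the shift: both sides contain \<open>C + 1\<close> times the probability
    that \<open>Y\<close> lies in \<open>B\<close>, and these terms cancel.\<close>
  have "k * (LINT \<omega>|M. indicator B (Y \<omega>)) = (LINT \<omega>|M. V \<omega> * indicator B (Y \<omega>))"
    using * kpos by (simp add: field_simps)
  also have "\<dots> = (LINT \<omega>|M. W \<omega> * indicator B (Y \<omega>) + (C + 1) * indicator B (Y \<omega>))"
    by (simp add: V_def algebra_simps)
  also have "\<dots> = (LINT \<omega>|M. W \<omega> * indicator B (Y \<omega>)) + (C + 1) * (LINT \<omega>|M. indicator B (Y \<omega>))"
    using i i' by simp
  finally show ?thesis
    by (simp add: k_def algebra_simps)
qed

text \<open>Taking real parts of the hypothesis would mix \<open>W\<close> with the complex
  exponential. Instead the identity is also derived for \<open>cnj W\<close> and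
  \<open>cnj K\<close>; combining the two yields the identities for \<open>Re W\<close> and
  \<open>Im W\<close>, to which the real case applies.\<close>

lemma (in prob_space) weighted_char_unique:
  fixes W :: "'a \<Rightarrow> complex" and Y :: "'a \<Rightarrow> real"
  assumes [measurable]: "W \<in> borel_measurable M" "Y \<in> borel_measurable M"
    and bound: "\<And>\<omega>. cmod (W \<omega>) \<le> C"
    and eq: "\<And>t. (CLINT \<omega>|M. W \<omega> * iexp (t * Y \<omega>)) = K * (CLINT \<omega>|M. iexp (t * Y \<omega>))"
    and [measurable]: "B \<in> sets borel"
  shows "(CLINT \<omega>|M. W \<omega> * indicator B (Y \<omega>)) = K * of_real (LINT \<omega>|M. indicator B (Y \<omega>))"
proof -
  define \<phi> where "\<phi> t = (CLINT \<omega>|M. iexp (t * Y \<omega>))" for t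
  have i: "integrable M (\<lambda>\<omega>. W \<omega> * iexp (t * Y \<omega>))" for t
    by (rule integrable_const_bound[of _ C]) (use bound in \<open>auto simp: norm_mult\<close>)
  have i': "integrable M (\<lambda>\<omega>. cnj (W \<omega>) * iexp (t * Y \<omega>))" for t
    using complex_integrable_cnj[THEN iffD2, OF i[of "- t"]] by (simp add: exp_cnj)
  have cnj\<phi>: "\<phi> t = cnj (\<phi> (- t))" for t
    by (simp add: \<phi>_def exp_cnj flip: Bochner_Integration.integral_cnj)
  \<comment> \<open>Conjugation reverses the sign in the exponent, so the hypothesis is used at
    \<open>- t\<close>.\<close>
  have eq': "(CLINT \<omega>|M. cnj (W \<omega>) * iexp (t * Y \<omega>)) = cnj K * \<phi> t" for t
  proof -
    have "(CLINT \<omega>|M. cnj (W \<omega>) * iexp (t * Y \<omega>)) = cnj (CLINT \<omega>|M. W \<omega> * iexp (- t * Y \<omega>))"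
      by (simp add: exp_cnj flip: Bochner_Integration.integral_cnj)
    then show ?thesis
      unfolding eq cnj\<phi>[of t] by (simp add: \<phi>_def)
  qed
  have Re: "(LINT \<omega>|M. Re (W \<omega>) * indicator B (Y \<omega>)) = Re K * (LINT \<omega>|M. indicator B (Y \<omega>))"
  proof (rule weighted_char_unique_real)
    show "\<bar>Re (W \<omega>)\<bar> \<le> C" for \<omega>
      using abs_Re_le_cmod[of "W \<omega>"] bound[of \<omega>] by linarith
    fix t
    have "(CLINT \<omega>|M. of_real (Re (W \<omega>)) * iexp (t * Y \<omega>))
        = (CLINT \<omega>|M. (W \<omega> * iexp (t * Y \<omega>) + cnj (W \<omega>) * iexp (t * Y \<omega>)) / 2)"
      by (rule Bochner_Integration.integral_cong)
         (simp_all add: ring_distribs(2)[symmetric] complex_add_cnj)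
    also have "\<dots> = ((CLINT \<omega>|M. W \<omega> * iexp (t * Y \<omega>))
        + (CLINT \<omega>|M. cnj (W \<omega>) * iexp (t * Y \<omega>))) / 2"
      using i[of t] i'[of t] by simp
    also have "\<dots> = (K + cnj K) / 2 * \<phi> t"
      unfolding eq eq' by (simp add: \<phi>_def field_simps)
    finally show "(CLINT \<omega>|M. of_real (Re (W \<omega>)) * iexp (t * Y \<omega>))
        = of_real (Re K) * (CLINT \<omega>|M. iexp (t * Y \<omega>))"
      by (simp add: complex_add_cnj \<phi>_def)
  qed auto
  have Im: "(LINT \<omega>|M. Im (W \<omega>) * indicator B (Y \<omega>)) = Im K * (LINT \<omega>|M. indicator B (Y \<omega>))"
  proof (rule weighted_char_unique_real)
    show "\<bar>Im (W \<omega>)\<bar> \<le> C" for \<omega>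
      using abs_Im_le_cmod[of "W \<omega>"] bound[of \<omega>] by linarith
    fix t
    have "(CLINT \<omega>|M. of_real (Im (W \<omega>)) * iexp (t * Y \<omega>))
        = (CLINT \<omega>|M. (W \<omega> * iexp (t * Y \<omega>) - cnj (W \<omega>) * iexp (t * Y \<omega>)) / (2 * \<i>))"
      by (rule Bochner_Integration.integral_cong)
         (simp_all add: left_diff_distrib[symmetric] complex_diff_cnj mult.left_commute[of "of_real _" \<i>])
    also have "\<dots> = ((CLINT \<omega>|M. W \<omega> * iexp (t * Y \<omega>))
        - (CLINT \<omega>|M. cnj (W \<omega>) * iexp (t * Y \<omega>))) / (2 * \<i>)"
      using i[of t] i'[of t] by simp
    also have "\<dots> = (K - cnj K) / (2 * \<i>) * \<phi> t"
      unfolding eq eq' by (simp add: \<phi>_def field_simps)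
    finally show "(CLINT \<omega>|M. of_real (Im (W \<omega>)) * iexp (t * Y \<omega>))
        = of_real (Im K) * (CLINT \<omega>|M. iexp (t * Y \<omega>))"
      by (simp add: complex_diff_cnj \<phi>_def mult.commute[of "of_real _" \<i>])
  qed auto
  have "0 \<le> C" using order_trans[OF norm_ge_zero bound] by blast
  then have int: "integrable M (\<lambda>\<omega>. W \<omega> * indicator B (Y \<omega>))"
    by (intro integrable_const_bound[of _ C]) (use bound in \<open>auto simp: indicator_def\<close>)
  have [simp]: "Re (indicator B y) = indicator B y" "Im (indicator B y) = 0" for y
    by (auto simp: indicator_def)
  show ?thesis
    using Re Im int by (intro complex_eqI) (simp_all flip: integral_Re integral_Im)
qed

text \<open>Induction on \<open>I\<close> with \<open>W\<close> and \<open>K\<close> arbitrary: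
  splitting off \<open>j\<close> moves the indicator of \<open>B j\<close> into the weight and its
  expectation into the constant, and the bound \<open>C\<close> survives.\<close>

lemma (in prob_space) weighted_joint_char_unique:
  fixes X :: "'i \<Rightarrow> 'a \<Rightarrow> real"
  assumes "finite I"
    and X: "\<And>i. i \<in> I \<Longrightarrow> X i \<in> borel_measurable M"
    and "W \<in> borel_measurable M" and "\<And>\<omega>. cmod (W \<omega>) \<le> C"
    and "\<And>u. (CLINT \<omega>|M. W \<omega> * iexp (\<Sum>i\<in>I. u i * X i \<omega>))
               = K * (\<Prod>i\<in>I. CLINT \<omega>|M. iexp (u i * X i \<omega>))"
    and B: "\<And>i. i \<in> I \<Longrightarrow> B i \<in> sets borel"
  shows "(CLINT \<omega>|M. W \<omega> * (\<Prod>i\<in>I. indicator (B i) (X i \<omega>)))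
         = K * of_real (\<Prod>i\<in>I. LINT \<omega>|M. indicator (B i) (X i \<omega>))"
  using assms
proof (induction I arbitrary: W K rule: finite_induct)
  case empty
  then show ?case by simp
next
  case (insert j I)
  note [measurable] = insert.prems(2)
  have [measurable]: "X j \<in> borel_measurable M" "B j \<in> sets borel"
    using insert.prems by auto
  have [measurable]: "i \<in> I \<Longrightarrow> X i \<in> borel_measurable M" for i
    using insert.prems by auto
  have "(CLINT \<omega>|M. W \<omega> * indicator (B j) (X j \<omega>) * (\<Prod>i\<in>I. indicator (B i) (X i \<omega>)))
      = K * of_real (LINT \<omega>|M. indicator (B j) (X j \<omega>)) * of_real (\<Prod>i\<in>I. LINT \<omega>|M. indicator (B i) (X i \<omega>))"
  proof (rule insert.IH)
    show "cmod (W \<omega> * indicator (B j) (X j \<omega>)) \<le> C" for \<omega>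
      using insert.prems(3)[of \<omega>] order_trans[OF norm_ge_zero insert.prems(3)[of \<omega>]]
      by (auto simp: indicator_def)
    fix u :: "'i \<Rightarrow> real"
    \<comment> \<open>With \<open>u\<close> fixed on \<open>I\<close>, the other exponentials have
      modulus 1 and join the weight. Only the coefficient \<open>t\<close> of \<open>X j\<close>
      varies, so one-dimensional uniqueness applies.\<close>
    have "(CLINT \<omega>|M. W \<omega> * iexp (\<Sum>i\<in>I. u i * X i \<omega>) * indicator (B j) (X j \<omega>))
        = K * (\<Prod>i\<in>I. CLINT \<omega>|M. iexp (u i * X i \<omega>)) * of_real (LINT \<omega>|M. indicator (B j) (X j \<omega>))"
    proof (rule weighted_char_unique)
      show "cmod (W \<omega> * iexp (\<Sum>i\<in>I. u i * X i \<omega>)) \<le> C" for \<omega>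
        using insert.prems(3)[of \<omega>] by (simp add: norm_mult)
      fix t
      \<comment> \<open>As \<open>j\<close> is not in \<open>I\<close>, updating \<open>u\<close> at
        \<open>j\<close> leaves the sum and the product over \<open>I\<close> unchanged, and the
        hypothesis at \<open>u(j := t)\<close> splits off the factor of \<open>j\<close>.\<close>
      have "(\<Sum>i\<in>I. (u(j := t)) i * X i \<omega>) = (\<Sum>i\<in>I. u i * X i \<omega>)" for \<omega>
        by (rule sum.cong) (use insert.hyps in auto)
      moreover have "(\<Prod>i\<in>I. CLINT \<omega>|M. iexp ((u(j := t)) i * X i \<omega>)) = (\<Prod>i\<in>I. CLINT \<omega>|M. iexp (u i * X i \<omega>))"
        by (rule prod.cong) (use insert.hyps in auto)
      ultimately show "(CLINT \<omega>|M. W \<omega> * iexp (\<Sum>i\<in>I. u i * X i \<omega>) * iexp (t * X j \<omega>))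
        = K * (\<Prod>i\<in>I. CLINT \<omega>|M. iexp (u i * X i \<omega>)) * (CLINT \<omega>|M. iexp (t * X j \<omega>))"
        using insert.prems(4)[of "u(j := t)"] insert.hyps
        by (simp add: exp_add ring_distribs mult_ac del: fun_upd_apply) (simp add: mult_ac)
    qed measurable
    then show "(CLINT \<omega>|M. W \<omega> * indicator (B j) (X j \<omega>) * iexp (\<Sum>i\<in>I. u i * X i \<omega>))
        = K * of_real (LINT \<omega>|M. indicator (B j) (X j \<omega>)) * (\<Prod>i\<in>I. CLINT \<omega>|M. iexp (u i * X i \<omega>))"
      by (simp add: mult_ac)
  qed (use insert.prems in \<open>auto intro!: borel_measurable_times\<close>)
  then show ?case
    using insert.hyps by (simp add: mult_ac)
qed

text \<open>Kac's theorem. The case of weight 1 and constant 1 above is the product rule for all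
  Borel rectangles, so the full Borel sigma-algebra can serve as its own intersection-stable
  generator.\<close>

theorem (in prob_space) indep_vars_if_joint_char_prod:
  fixes X :: "'i \<Rightarrow> 'a \<Rightarrow> real"
  assumes I: "finite I" "I \<noteq> {}"
    and X: "\<And>i. i \<in> I \<Longrightarrow> X i \<in> borel_measurable M"
    and eq: "\<And>u. (CLINT \<omega>|M. iexp (\<Sum>i\<in>I. u i * X i \<omega>)) = (\<Prod>i\<in>I. CLINT \<omega>|M. iexp (u i * X i \<omega>))"
  shows "indep_vars (\<lambda>_. borel) X I"
proof (subst indep_vars_finite[where E="\<lambda>_. sets borel"])
  show "\<forall>A\<in>(I \<rightarrow> sets borel).
      prob (\<Inter>j\<in>I. X j -` A j \<inter> space M) = (\<Prod>j\<in>I. prob (X j -` A j \<inter> space M))"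
  proof
    fix A assume A: "A \<in> I \<rightarrow> sets (borel :: real measure)"
    have meas: "X i -` A i \<inter> space M \<in> sets M" if "i \<in> I" for i
      using A X that by (auto intro: measurable_sets)
    have one: "(LINT \<omega>|M. indicator (A i) (X i \<omega>)) = prob (X i -` A i \<inter> space M)" if "i \<in> I" for i
    proof -
      have "(LINT \<omega>|M. indicator (A i) (X i \<omega>)) = (LINT \<omega>|M. indicator (X i -` A i \<inter> space M) \<omega> :: real)"
        by (rule Bochner_Integration.integral_cong) (auto simp: indicator_def)
      then show ?thesis using meas[OF that] by simp
    qed
    have "(CLINT \<omega>|M. 1 * (\<Prod>i\<in>I. indicator (A i) (X i \<omega>)))
        = 1 * of_real (\<Prod>i\<in>I. LINT \<omega>|M. indicator (A i) (X i \<omega>))"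
      by (rule weighted_joint_char_unique[where C=1]) (use I X eq A in auto)
    also have "(CLINT \<omega>|M. 1 * (\<Prod>i\<in>I. indicator (A i) (X i \<omega>)))
        = (CLINT \<omega>|M. of_real (indicat_real (\<Inter>j\<in>I. X j -` A j \<inter> space M) \<omega>))"
      using I by (intro Bochner_Integration.integral_cong) (auto simp: indicator_def prod_eq_1_iff prod_zero_iff)
    also have "\<dots> = of_real (prob (\<Inter>j\<in>I. X j -` A j \<inter> space M))"
      using I by (subst integral_complex_of_real) (auto intro!: arg_cong[where f=prob])
    finally show "prob (\<Inter>j\<in>I. X j -` A j \<inter> space M) = (\<Prod>j\<in>I. prob (X j -` A j \<inter> space M))"
      by (simp add: one del: of_real_prod)
  qed
qed (use I X in \<open>auto simp: Int_stable_def sets.sigma_sets_eq[of borel, simplified]\<close>)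

section \<open>Cauchy's functional equation in multiplicative form\<close>

text \<open>The equation determines \<open>g\<close> at nonnegative rationals from
  \<open>g 1\<close>, and continuity does the rest. The condition \<open>g 0 = 1\<close> excludes
  the zero function.\<close>

lemma continuous_multiplicative_imp_exp:
  fixes g :: "real \<Rightarrow> real"
  assumes mult: "\<And>x y. 0 \<le> x \<Longrightarrow> 0 \<le> y \<Longrightarrow> g (x + y) = g x * g y"
    and cont: "continuous_on {0..} g" and g0: "g 0 = 1"
  shows "\<exists>c. \<forall>x\<ge>0. g x = exp (- c * x)"
proof -
  have pow: "g (real k * x) = g x ^ k" if "0 \<le> x" for k x
    by (induction k) (use that in \<open>simp_all add: g0 mult ring_distribs\<close>)
  have lim: "(\<lambda>N. g (y N)) \<longlonglongrightarrow> g x" if "y \<longlonglongrightarrow> x" "\<And>N. 0 \<le> y N" "0 \<le> x" for y x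
    using continuous_on_tendsto_compose[OF cont that(1)] that by simp
  \<comment> \<open>\<open>g x\<close> is the square of \<open>g (x / 2)\<close>.\<close>
  have nonneg: "0 \<le> g x" if "0 \<le> x" for x
    using pow[of "x / 2" 2] that by simp
  \<comment> \<open>Continuity at 0 makes \<open>g\<close> positive at some
    \<open>1 / real (Suc N)\<close>. Since \<open>g 1\<close> is a power of that value, it is
    positive too and \<open>ln (g 1)\<close> is meaningful.\<close>
  have "(\<lambda>N. g (1 / real (Suc N))) \<longlonglongrightarrow> g 0"
    by (rule lim) (use LIMSEQ_Suc[OF lim_inverse_n'] in auto)
  then have "eventually (\<lambda>N. g (1 / real (Suc N)) > 0) sequentially"
    by (rule order_tendstoD) (simp add: g0)
  then obtain N where "g (1 / real (Suc N)) > 0"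
    by (auto simp: eventually_sequentially)
  then have "g 1 > 0"
    using pow[of "1 / real (Suc N)" "Suc N"] by (simp del: power_Suc)
  define c where "c = - ln (g 1)"
  have frac: "g (real k / real (Suc N)) = exp (- c * (real k / real (Suc N)))" for k N
  proof -
    \<comment> \<open>Both bases are nonnegative roots of \<open>g 1\<close> of the same positive
      order, hence equal.\<close>
    have "g (1 / real (Suc N)) ^ Suc N = exp (- c / real (Suc N)) ^ Suc N"
      using pow[of "1 / real (Suc N)" "Suc N"] \<open>g 1 > 0\<close>
      by (simp add: c_def del: power_Suc flip: exp_of_nat_mult)
    then have "g (1 / real (Suc N)) = exp (- c / real (Suc N))"
      by (rule power_eq_imp_eq_base) (auto intro: nonneg)
    then show ?thesis
      using pow[of "1 / real (Suc N)" k] by (simp flip: exp_of_nat_mult)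
  qed
  have "g x = exp (- c * x)" if "0 \<le> x" for x
  proof -
    \<comment> \<open>The largest multiple of \<open>1 / real (Suc N)\<close> not exceeding
      \<open>x\<close>: a nonnegative rational within \<open>1 / real (Suc N)\<close> of
      \<open>x\<close>.\<close>
    define y where "y N = real (nat \<lfloor>real (Suc N) * x\<rfloor>) / real (Suc N)" for N
    have y: "y N = of_int \<lfloor>real (Suc N) * x\<rfloor> / real (Suc N)" for N
      using that by (simp add: y_def)
    have "x - 1 / real (Suc N) \<le> y N \<and> y N \<le> x" for N
    proof -
      have "x - 1 / real (Suc N) = (real (Suc N) * x - 1) / real (Suc N)"
        "x = real (Suc N) * x / real (Suc N)"
        by (simp_all add: diff_divide_distrib)
      moreover have "(real (Suc N) * x - 1) / real (Suc N) \<le> y N" "y N \<le> real (Suc N) * x / real (Suc N)"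
        unfolding y using floor_correct[of "real (Suc N) * x"]
        by (intro divide_right_mono; linarith)+
      ultimately show ?thesis by metis
    qed
    moreover have "(\<lambda>N. x - 1 / real (Suc N)) \<longlonglongrightarrow> x"
      using tendsto_diff[OF tendsto_const LIMSEQ_Suc[OF lim_inverse_n']] by simp
    ultimately have "y \<longlonglongrightarrow> x"
      by (intro tendsto_sandwich[of "\<lambda>N. x - 1 / real (Suc N)" y _ "\<lambda>_. x" x]) auto
    moreover have "0 \<le> y N" for N by (simp add: y_def)
    ultimately have "(\<lambda>N. g (y N)) \<longlonglongrightarrow> g x" "(\<lambda>N. exp (- c * y N)) \<longlonglongrightarrow> exp (- c * x)"
      using that by (auto intro!: lim tendsto_intros)
    moreover have "g (y N) = exp (- c * y N)" for N
      unfolding y_def by (rule frac)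
    ultimately show ?thesis
      using LIMSEQ_unique by fastforce
  qed
  then show ?thesis by blast
qed

section \<open>Radial joint characteristic functions and their Gaussian form\<close>

lemma (in prob_space) joint_char_radial:
  fixes X :: "'i \<Rightarrow> 'a \<Rightarrow> real"
  assumes X [measurable]: "\<And>i. i \<in> I \<Longrightarrow> X i \<in> borel_measurable M"
    and stat: "\<And>a a' :: 'i \<Rightarrow> real. (\<Sum>i\<in>I. (a i)\<^sup>2) = (\<Sum>i\<in>I. (a' i)\<^sup>2) \<Longrightarrow>
           distr M borel (\<lambda>\<omega>. \<Sum>i\<in>I. (X i \<omega> + a i)\<^sup>2) =
           distr M borel (\<lambda>\<omega>. \<Sum>i\<in>I. (X i \<omega> + a' i)\<^sup>2)"
    and r: "(\<Sum>i\<in>I. (u i)\<^sup>2) = (\<Sum>i\<in>I. (u' i)\<^sup>2)"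
  shows "(CLINT \<omega>|M. iexp (\<Sum>i\<in>I. u i * X i \<omega>)) = (CLINT \<omega>|M. iexp (\<Sum>i\<in>I. u' i * X i \<omega>))"
proof -
  define q where "q \<omega> = (\<Sum>i\<in>I. (X i \<omega>)\<^sup>2)" for \<omega>
  have [measurable]: "q \<in> borel_measurable M"
    unfolding q_def by measurable
  \<comment> \<open>The characteristic function at 1 of the statistic with shift
    \<open>t * v i\<close>, after subtracting the constant
    \<open>(\<Sum>i\<in>I. (t * v i)\<^sup>2)\<close> and dividing by \<open>2 * t\<close>; the
    quadratic part \<open>q\<close> then carries the vanishing factor
    \<open>1 / (2 * t)\<close>.\<close>
  define J where "J v t = (CLINT \<omega>|M. iexp (q \<omega> / (2 * t) + (\<Sum>i\<in>I. v i * X i \<omega>)))" for v t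
  have J_distr: "J v t = (CLINT y|distr M borel (\<lambda>\<omega>. \<Sum>i\<in>I. (X i \<omega> + t * v i)\<^sup>2).
                     iexp ((y - (\<Sum>i\<in>I. (t * v i)\<^sup>2)) / (2 * t)))" if "t > 0" for v t
  proof -
    have s: "((\<Sum>i\<in>I. (X i \<omega> + t * v i)\<^sup>2) - (\<Sum>i\<in>I. (t * v i)\<^sup>2)) / (2 * t)
        = q \<omega> / (2 * t) + (\<Sum>i\<in>I. v i * X i \<omega>)" for \<omega>
    proof -
      have "(\<Sum>i\<in>I. (X i \<omega> + t * v i)\<^sup>2) = q \<omega> + 2 * t * (\<Sum>i\<in>I. v i * X i \<omega>) + (\<Sum>i\<in>I. (t * v i)\<^sup>2)"
        unfolding q_def sum_distrib_left sum.distrib[symmetric]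
        by (rule sum.cong) (auto simp: power2_sum)
      then show ?thesis using that by (simp add: field_simps)
    qed
    show ?thesis
      unfolding J_def s[symmetric] by (rule integral_distr[symmetric]) measurable
  qed
  have lim: "(\<lambda>N. J v (real (Suc N))) \<longlonglongrightarrow> (CLINT \<omega>|M. iexp (\<Sum>i\<in>I. v i * X i \<omega>))" for v
    unfolding J_def
  proof (rule integral_dominated_convergence[where w="\<lambda>_. 1"])
    show "AE \<omega> in M. (\<lambda>N. iexp (q \<omega> / (2 * real (Suc N)) + (\<Sum>i\<in>I. v i * X i \<omega>)))
                      \<longlonglongrightarrow> iexp (\<Sum>i\<in>I. v i * X i \<omega>)"
    proof (rule AE_I2)
      fix \<omega>
      have "(\<lambda>N. q \<omega> / (2 * real (Suc N)) + (\<Sum>i\<in>I. v i * X i \<omega>)) \<longlonglongrightarrow> (\<Sum>i\<in>I. v i * X i \<omega>)"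
        using tendsto_add[OF tendsto_mult[OF tendsto_const LIMSEQ_Suc[OF lim_inverse_n']] tendsto_const,
            of "q \<omega> / 2" "\<Sum>i\<in>I. v i * X i \<omega>"]
        by simp
      then show "(\<lambda>N. iexp (q \<omega> / (2 * real (Suc N)) + (\<Sum>i\<in>I. v i * X i \<omega>)))
                      \<longlonglongrightarrow> iexp (\<Sum>i\<in>I. v i * X i \<omega>)"
        by (rule isCont_tendsto_compose[OF isCont_iexp])
    qed
  qed auto
  have "J u t = J u' t" if "t > 0" for t
  proof -
    \<comment> \<open>Scaling by \<open>t\<close> preserves equality of the norms. Hence the two
      statistics have the same law and are centred by the same constant.\<close>
    have "(\<Sum>i\<in>I. (t * u i)\<^sup>2) = (\<Sum>i\<in>I. (t * u' i)\<^sup>2)"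
      using r by (simp add: power_mult_distrib flip: sum_distrib_left)
    then show ?thesis
      using stat[of "\<lambda>i. t * u i" "\<lambda>i. t * u' i"] that by (simp add: J_distr)
  qed
  then have "(\<lambda>N. J u (real (Suc N))) = (\<lambda>N. J u' (real (Suc N)))" by simp
  then show ?thesis
    using LIMSEQ_unique[OF lim[of u]] lim[of u'] by simp
qed


text \<open>A single independent pair suffices: on the plane of the coordinates \<open>p\<close> and
  \<open>q\<close> the characteristic function factorises, which fixes the radial profile, and
  radiality carries it to every \<open>u\<close>.\<close>

lemma (in prob_space) radial_char_indep_imp_gaussian_char:
  fixes X :: "'i \<Rightarrow> 'a \<Rightarrow> real"
  assumes "finite I" and X: "\<And>i. i \<in> I \<Longrightarrow> X i \<in> borel_measurable M"
    and pq: "p \<in> I" "q \<in> I" "p \<noteq> q" and indep: "indep_var borel (X p) borel (X q)"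
    and radial: "\<And>u u'. (\<Sum>i\<in>I. (u i)\<^sup>2) = (\<Sum>i\<in>I. (u' i)\<^sup>2) \<Longrightarrow>
      (CLINT \<omega>|M. iexp (\<Sum>i\<in>I. u i * X i \<omega>)) = (CLINT \<omega>|M. iexp (\<Sum>i\<in>I. u' i * X i \<omega>))"
  shows "\<exists>c\<ge>0. \<forall>u. (CLINT \<omega>|M. iexp (\<Sum>i\<in>I. u i * X i \<omega>)) = of_real (exp (- c * (\<Sum>i\<in>I. (u i)\<^sup>2)))"
proof -
  define \<phi> where "\<phi> u = (CLINT \<omega>|M. iexp (\<Sum>i\<in>I. u i * X i \<omega>))" for u
  define e where "e i t = (\<lambda>j. if j = i then t else 0)" for i :: 'i and t :: real
  have [measurable]: "X p \<in> borel_measurable M" "X q \<in> borel_measurable M"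
    using X pq by auto
  interpret p: real_distribution "distr M borel (X p)"
    by (rule real_distribution_distr) simp
  \<comment> \<open>The radial profile: \<open>f t\<close> is the value of \<open>\<phi>\<close> at
    \<open>t\<close> times the unit vector of \<open>p\<close>, hence at every vector whose squared
    norm is \<open>t\<^sup>2\<close>.\<close>
  define f where "f = char (distr M borel (X p))"
  have esum: "(\<Sum>j\<in>I. e i t j * h j) = t * h i" "(\<Sum>j\<in>I. (e i t j)\<^sup>2) = t\<^sup>2"
    if "i \<in> I" for i t and h :: "'i \<Rightarrow> real"
  proof -
    have "(\<Sum>j\<in>I. e i t j * h j) = (\<Sum>j\<in>I. if j = i then t * h i else 0)"
      by (rule sum.cong) (auto simp: e_def)
    then show "(\<Sum>j\<in>I. e i t j * h j) = t * h i"
      using that \<open>finite I\<close> by simp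
    have "(\<Sum>j\<in>I. (e i t j)\<^sup>2) = (\<Sum>j\<in>I. if j = i then t\<^sup>2 else 0)"
      by (rule sum.cong) (auto simp: e_def)
    then show "(\<Sum>j\<in>I. (e i t j)\<^sup>2) = t\<^sup>2"
      using that \<open>finite I\<close> by simp
  qed
  have f_\<phi>: "f t = \<phi> (e p t)" for t
    by (simp add: f_def char_def \<phi>_def esum pq integral_distr del: of_real_sum)
  have \<phi>_f: "\<phi> u = f t" if "(\<Sum>i\<in>I. (u i)\<^sup>2) = t\<^sup>2" for u t
    unfolding f_\<phi> \<phi>_def by (rule radial) (simp add: that esum pq)
  have f_q: "f t = char (distr M borel (X q)) t" for t
  proof -
    have "char (distr M borel (X q)) t = \<phi> (e q t)"
      by (simp add: char_def \<phi>_def esum pq integral_distr del: of_real_sum)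
    also have "\<dots> = f t" by (rule \<phi>_f) (simp add: esum pq)
    finally show ?thesis by simp
  qed
  \<comment> \<open>Opposite vectors have equal norm. Evenness together with conjugate symmetry
    makes \<open>f\<close> real, so that the real functional equation can be used.\<close>
  have f_even: "f (- t) = f t" for t
    using \<phi>_f[of "e p t" "- t"] by (simp add: esum pq f_\<phi>)
  have "f (- t) = cnj (f t)" for t
    
    by (simp add: f_def char_def integral_distr exp_cnj flip: Bochner_Integration.integral_cnj)
  then have f_real: "f t = of_real (Re (f t))" for t
    using f_even[of t] by (simp add: complex_eq_iff)
  have f_mult: "f (sqrt (s\<^sup>2 + t\<^sup>2)) = f s * f t" for s t
  proof -
    \<comment> \<open>The vector with entries \<open>s\<close> at \<open>p\<close> and
      \<open>t\<close> at \<open>q\<close>. Its squared norm is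
      \<open>s\<^sup>2 + t\<^sup>2\<close>, while its linear form is a sum of two independent
      variables.\<close>
    let ?u = "\<lambda>i. e p s i + e q t i"
    have "(\<Sum>i\<in>I. (?u i)\<^sup>2) = (\<Sum>i\<in>I. (e p s i)\<^sup>2 + (e q t i)\<^sup>2)"
      by (rule sum.cong) (use pq in \<open>auto simp: e_def\<close>)
    then have "f (sqrt (s\<^sup>2 + t\<^sup>2)) = \<phi> ?u"
      by (intro \<phi>_f[symmetric]) (simp add: sum.distrib esum pq)
    also have "\<dots> = (CLINT \<omega>|M. iexp (1 * (s * X p \<omega> + t * X q \<omega>)))"
      unfolding \<phi>_def by (simp only: ring_distribs sum.distrib esum pq mult_1)
    also have "\<dots> = char (distr M borel (\<lambda>\<omega>. s * X p \<omega> + t * X q \<omega>)) 1"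
      unfolding char_def by (rule integral_distr[symmetric]) measurable
    also have "\<dots> = char (distr M borel (\<lambda>\<omega>. s * X p \<omega>)) 1 * char (distr M borel (\<lambda>\<omega>. t * X q \<omega>)) 1"
    proof (rule char_distr_add)
      show "indep_var borel (\<lambda>\<omega>. s * X p \<omega>) borel (\<lambda>\<omega>. t * X q \<omega>)"
        using indep_var_compose[OF indep, of "\<lambda>x. s * x" borel "\<lambda>x. t * x" borel]
        by (simp add: comp_def)
    qed
    also have "\<dots> = f s * f t"
      unfolding f_q[of t] by (simp add: f_def char_def integral_distr)
    finally show ?thesis .
  qed
  \<comment> \<open>In terms of the squared radius, \<open>f_mult\<close> becomes the multiplicative
    Cauchy equation.\<close>
  define g where "g x = Re (f (sqrt x))" for x
  have "\<exists>c. \<forall>x\<ge>0. g x = exp (- c * x)"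
  proof (rule continuous_multiplicative_imp_exp)
    fix x y :: real assume "0 \<le> x" "0 \<le> y"
    then have "f (sqrt (x + y)) = f (sqrt x) * f (sqrt y)"
      using f_mult[of "sqrt x" "sqrt y"] by simp
    then show "g (x + y) = g x * g y"
      using f_real[of "sqrt x"] f_real[of "sqrt y"] by (simp add: g_def complex_eq_iff)
  next
    have "continuous_on UNIV f"
      unfolding f_def by (simp add: continuous_at_imp_continuous_on p.isCont_char)
    then show "continuous_on {0..} g"
      unfolding g_def
      by (intro continuous_intros continuous_on_compose2[of UNIV f "{0..}" sqrt]) auto
    show "g 0 = 1"
      by (simp add: g_def f_def p.char_zero)
  qed
  then obtain c where c: "\<And>x. 0 \<le> x \<Longrightarrow> g x = exp (- c * x)" by blast
  \<comment> \<open>A characteristic function has modulus at most 1, which determines the sign of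
    \<open>c\<close>.\<close>
  have "exp (- c) = Re (f 1)"
    using c[of 1] by (simp add: g_def)
  also have "\<dots> \<le> 1"
    using complex_Re_le_cmod[of "f 1"] p.cmod_char_le_1[of 1] unfolding f_def by linarith
  finally have "0 \<le> c" by simp
  moreover have "\<phi> u = of_real (exp (- c * (\<Sum>i\<in>I. (u i)\<^sup>2)))" for u
  proof -
    have nn: "0 \<le> (\<Sum>i\<in>I. (u i)\<^sup>2)" by (simp add: sum_nonneg)
    then have "\<phi> u = f (sqrt (\<Sum>i\<in>I. (u i)\<^sup>2))"
      by (intro \<phi>_f) simp
    also have "\<dots> = of_real (g (\<Sum>i\<in>I. (u i)\<^sup>2))"
      unfolding g_def by (rule f_real)
    finally show ?thesis using c[OF nn] by simp
  qed
  ultimately show ?thesis unfolding \<phi>_def by blast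
qed

section \<open>Recognising normal and degenerate laws\<close>

text \<open>Dividing by \<open>\<sigma>\<close> reduces to the standard normal law, whose
  characteristic function is known; the normal density is then scaled back.\<close>

lemma (in prob_space) gaussian_char_imp_distributed:
  assumes [measurable]: "Y \<in> borel_measurable M" and \<sigma>: "0 < \<sigma>"
    and char: "\<And>t. (CLINT \<omega>|M. iexp (t * Y \<omega>)) = of_real (exp (- (\<sigma> * t)\<^sup>2 / 2))"
  shows "distributed M lborel Y (normal_density 0 \<sigma>)"
proof -
  have "distr M borel (\<lambda>\<omega>. Y \<omega> / \<sigma>) = std_normal_distribution"
  proof (rule Levy_uniqueness)
    show "real_distribution (distr M borel (\<lambda>\<omega>. Y \<omega> / \<sigma>))"
      by (rule real_distribution_distr) simp
    show "char (distr M borel (\<lambda>\<omega>. Y \<omega> / \<sigma>)) = char std_normal_distribution"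
    proof
      fix t
      have "char (distr M borel (\<lambda>\<omega>. Y \<omega> / \<sigma>)) t = (CLINT \<omega>|M. iexp (t / \<sigma> * Y \<omega>))"
        by (simp add: char_def integral_distr)
      then show "char (distr M borel (\<lambda>\<omega>. Y \<omega> / \<sigma>)) t = char std_normal_distribution t"
        using char[of "t / \<sigma>"] \<sigma> by (simp add: char_std_normal_distribution)
    qed
  qed (rule real_dist_normal_dist)
  moreover have "distr M lborel (\<lambda>\<omega>. Y \<omega> / \<sigma>) = distr M borel (\<lambda>\<omega>. Y \<omega> / \<sigma>)"
    by (rule distr_cong) auto
  ultimately show ?thesis
    using normal_standard_normal_convert[OF \<sigma>, of Y 0]
    by (simp add: distributed_def)
qed

text \<open>The constant 1 is the characteristic function of the point mass at 0. This serves to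
  exclude \<open>c = 0\<close> in the final proof.\<close>

lemma (in prob_space) char_eq_1_imp_AE_0:
  assumes [measurable]: "Y \<in> borel_measurable M"
    and char: "\<And>t. (CLINT \<omega>|M. iexp (t * Y \<omega>)) = 1"
  shows "AE \<omega> in M. Y \<omega> = 0"
proof -
  have "distr M borel Y = return borel 0"
  proof (rule Levy_uniqueness)
    show "real_distribution (distr M borel Y)"
      by (rule real_distribution_distr) simp
    show "real_distribution (return borel 0)"
      by (simp add: real_distribution_def real_distribution_axioms_def prob_space_return)
    show "char (distr M borel Y) = char (return borel 0)"
      by (rule ext) (use char in \<open>simp add: char_def integral_distr integral_return\<close>)
  qed
  moreover have "AE y in return borel (0 :: real). y = 0"
    by (simp add: AE_return)
  ultimately have "AE y in distr M borel Y. y = 0"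
    by metis
  then show ?thesis
    by (simp add: AE_distr_iff)
qed

section \<open>Assembly of independence and normality\<close>

theorem corollary3p3:
  fixes M :: "'a measure" and X :: "nat \<Rightarrow> 'a \<Rightarrow> real" and m n :: nat
  assumes "prob_space M"
    and "1 \<le> m" and "m < n"
    and "\<And>i. i \<in> {1..n} \<Longrightarrow> X i \<in> borel_measurable M"
    and "\<And>i. i \<in> {1..n} \<Longrightarrow> finite_moments M (X i)"
    and "\<And>i. i \<in> {1..n} \<Longrightarrow> nondegenerate M (X i)"
    and "prob_space.indep_var M
           (\<Pi>\<^sub>M i\<in>{1..m}. (borel :: real measure)) (\<lambda>\<omega>. \<lambda>i\<in>{1..m}. X i \<omega>)
           (\<Pi>\<^sub>M i\<in>{m+1..n}. (borel :: real measure)) (\<lambda>\<omega>. \<lambda>i\<in>{m+1..n}. X i \<omega>)"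
    and "\<And>a a' :: nat \<Rightarrow> real.
           (\<Sum>i=1..n. (a i)\<^sup>2) = (\<Sum>i=1..n. (a' i)\<^sup>2) \<Longrightarrow>
           distr M borel (\<lambda>\<omega>. \<Sum>i=1..n. (X i \<omega> + a i)\<^sup>2) =
           distr M borel (\<lambda>\<omega>. \<Sum>i=1..n. (X i \<omega> + a' i)\<^sup>2)"
  shows "prob_space.indep_vars M (\<lambda>i. borel) X {1..n} \<and>
         (\<exists>\<sigma>>0. \<forall>i\<in>{1..n}. distributed M lborel (X i) (normal_density 0 \<sigma>))"
proof -
  interpret prob_space M by (rule assms(1))
  note X = assms(4)
  have in_range: "1 \<in> {1..n}" "n \<in> {1..n}" "1 \<noteq> n"
    using assms(2,3) by auto
  have [measurable]: "(\<lambda>f. f 1) \<in> borel_measurable (\<Pi>\<^sub>M i\<in>{1..m}. (borel :: real measure))"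
    "(\<lambda>f. f n) \<in> borel_measurable (\<Pi>\<^sub>M i\<in>{m+1..n}. (borel :: real measure))"
    using assms(2,3) by (auto intro!: measurable_component_singleton)
  \<comment> \<open>Index 1 lies in the first block and \<open>n\<close> in the second, so
    projecting the independent blocks to these coordinates gives the required independent
    pair.\<close>
  have "indep_var borel ((\<lambda>f. f 1) \<circ> (\<lambda>\<omega>. \<lambda>i\<in>{1..m}. X i \<omega>))
                  borel ((\<lambda>f. f n) \<circ> (\<lambda>\<omega>. \<lambda>i\<in>{m+1..n}. X i \<omega>))"
    by (rule indep_var_compose[OF assms(7)]) measurable
  then have "indep_var borel (X 1) borel (X n)"
    using assms(2,3) by (simp add: comp_def)
  from radial_char_indep_imp_gaussian_char[OF _ X in_range this joint_char_radial[OF X assms(8)]]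
  obtain c where "0 \<le> c"
    and joint: "\<And>u. (CLINT \<omega>|M. iexp (\<Sum>i=1..n. u i * X i \<omega>)) = of_real (exp (- c * (\<Sum>i=1..n. (u i)\<^sup>2)))"
    by auto
  \<comment> \<open>Specialise \<open>u\<close> to \<open>t\<close> times the unit vector of
    \<open>i\<close>.\<close>
  have marginal: "(CLINT \<omega>|M. iexp (t * X i \<omega>)) = of_real (exp (- c * t\<^sup>2))" if "i \<in> {1..n}" for i t
  proof -
    have "(\<Sum>j=1..n. (if j = i then t else 0) * X j \<omega>) = t * X i \<omega>" for \<omega>
      using that by (simp add: if_distrib[of "\<lambda>x. x * _"] cong: if_cong)
    moreover have "(\<Sum>j=1..n. (if j = i then t else 0)\<^sup>2) = t\<^sup>2"
      using that by (simp add: if_distrib[of "\<lambda>x. x\<^sup>2"] cong: if_cong)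
    ultimately show ?thesis
      using joint[of "\<lambda>j. if j = i then t else 0"] by (simp only:)
  qed
  have "c \<noteq> 0"
  proof
    assume "c = 0"
    then have "AE \<omega> in M. X 1 \<omega> = 0"
      using marginal[OF in_range(1)] by (intro char_eq_1_imp_AE_0 X in_range) simp
    then show False
      using assms(6)[OF in_range(1)] by (auto simp: nondegenerate_def)
  qed
  with \<open>0 \<le> c\<close> have "c > 0" by simp
  have "indep_vars (\<lambda>i. borel) X {1..n}"
  proof (rule indep_vars_if_joint_char_prod)
    fix u
    show "(CLINT \<omega>|M. iexp (\<Sum>i=1..n. u i * X i \<omega>)) = (\<Prod>i=1..n. CLINT \<omega>|M. iexp (u i * X i \<omega>))"
    proof -
      have "(\<Prod>i=1..n. CLINT \<omega>|M. iexp (u i * X i \<omega>)) = (\<Prod>i=1..n. of_real (exp (- c * (u i)\<^sup>2)))"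
        by (intro prod.cong refl marginal)
      then show ?thesis
        unfolding joint by (simp add: sum_distrib_left exp_sum flip: of_real_prod)
    qed
  qed (use X in_range in auto)
  \<comment> \<open>The value \<open>sqrt (2 * c)\<close> solves
    \<open>\<sigma>\<^sup>2 / 2 = c\<close>, matching \<open>exp (- c * t\<^sup>2)\<close> with the
    Gaussian characteristic function; it is the same for all \<open>i\<close>.\<close>
  moreover have "distributed M lborel (X i) (normal_density 0 (sqrt (2 * c)))" if "i \<in> {1..n}" for i
    using X[OF that] marginal[OF that] \<open>c > 0\<close>
    by (intro gaussian_char_imp_distributed) (simp_all add: power_mult_distrib)
  ultimately show ?thesis
    using \<open>c > 0\<close> by (intro conjI exI[of _ "sqrt (2 * c)"]) auto
qed

end
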